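(* Consider the sequential lifting process, described in the context, for the knapsack set $\mathcal{X}=\{\boldsymbol{x}\in\{0,1\}^n:\sum_{i=1}^n a_i x_i\le b\}$. If $F_k(z)$ is known for all $z\in\big[(b-\sum_{i=k+1}^n a_i)^+,\,b\big]$, then the coefficients $\alpha_{k+1},\dots,\alpha_n$ can be calculated by the up-lifting formula, the down-lifting formula and the Bellman recursion given in the context, where $(c)^+=\max\{c,0\}$.
   Context: Data: $N=\{1,\dots,n\}$; weights $a_i\in\mathbb{Q}_+$ and capacity $b\in\mathbb{Q}_+$ with $0<a_i\le b$ for all $i\in N$ and $\sum_{i=1}^n a_i>b$; a partition $(C,N_0,N_1)$ of $N$ with $C=\{1,\dots,\ell\}$; and a seed inequality $\sum_{i=1}^{\ell}\alpha_i x_i\le\beta^\ell$ valid for the convex hull of $\mathcal{X}(N_0,N_1)=\{\boldsymbol{x}\in\mathcal{X}: x_i=0\ \forall i\in N_0,\ x_i=1\ \forall i\in N_1\}$. The variables are lifted one by one in the order $\ell+1,\dots,n$. Knapsack values: for capacity $z\le b$, $$F_k(z)=\max_{\boldsymbol{x}\in\{0,1\}^k}\Big\{\sum_{i=1}^k\alpha_i x_i:\ \sum_{i=1}^k a_i x_i\le z\Big\}.$$ Sequential lifting process: suppose $x_{\ell+1},\dots,x_k$ have already been lifted (none of them if $k=\ell$), giving coefficients $\alpha_1,\dots,\alpha_k$. Put $N_0^k=N_0\setminus\{\ell+1,\dots,k\}$, $N_1^k=N_1\setminus\{\ell+1,\dots,k\}$, $b^k=b-\sum_{i\in N_1^k}a_i$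 and $\beta^k=\beta^\ell+\sum_{i\in N_1\setminus N_1^k}\alpha_i$. Then $x_{k+1}$ is lifted as follows. - Up-lifting formula, if $k+1\in N_0^k$: $\alpha_{k+1}=\beta^k-F_k(b^k-a_{k+1})$, with $\alpha_{k+1}=0$ if $b^k<a_{k+1}$ (infeasible problem); then $b^{k+1}=b^k$ and $\beta^{k+1}=\beta^k$. - Down-lifting formula, if $k+1\in N_1^k$: $\alpha_{k+1}=F_k(b^k+a_{k+1})-\beta^k$ (this problem is taken to be always feasible, with $b^k+a_{k+1}>0$); then $b^{k+1}=b^k+a_{k+1}$ and $\beta^{k+1}=\beta^k+\alpha_{k+1}$. The process continues with $k+1$ in place of $k$, until $x_n$ has been lifted. Bellman recursion: $F_{k+1}(z)=F_k(z)$ if $z<a_{k+1}$, and $F_{k+1}(z)=\max\{F_k(z),\,F_k(z-a_{k+1})+\alpha_{k+1}\}$ if $z\ge a_{k+1}$. *)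

theory Defs
  imports "HOL-Analysis.Analysis" "HOL-Library.Function_Algebras"
begin

text \<open>Pointwise scaling makes functions a real vector space, so that the library's convex hull
  applies to vectors represented as functions on the indices \<open>1, \<dots>, n\<close>.\<close>

instantiation "fun" :: (type, real_vector) real_vector
begin

definition scaleR_fun :: "real \<Rightarrow> ('a \<Rightarrow> 'b) \<Rightarrow> 'a \<Rightarrow> 'b"
  where "scaleR_fun c f = (\<lambda>x. c *\<^sub>R f x)"

instance
  by standard
    (auto simp: scaleR_fun_def fun_eq_iff scaleR_add_right scaleR_add_left)

end

text \<open>A vector of dimension \<open>k\<close> is a function on \<open>nat\<close> that vanishes outside \<open>{1..k}\<close>; this
  makes the representation unique and the set of binary vectors finite.\<close>

definition binary_vectors :: "nat \<Rightarrow> (nat \<Rightarrow> real) set"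
  where "binary_vectors k =
    {x. (\<forall>i\<in>{1..k}. x i \<in> {0, 1}) \<and> (\<forall>i. i \<notin> {1..k} \<longrightarrow> x i = 0)}"

definition knapsack_set :: "nat \<Rightarrow> (nat \<Rightarrow> real) \<Rightarrow> real \<Rightarrow> (nat \<Rightarrow> real) set"
  where "knapsack_set k a z = {x \<in> binary_vectors k. (\<Sum>i=1..k. a i * x i) \<le> z}"

definition restricted_knapsack_set ::
    "nat \<Rightarrow> (nat \<Rightarrow> real) \<Rightarrow> real \<Rightarrow> nat set \<Rightarrow> nat set \<Rightarrow> (nat \<Rightarrow> real) set"
  where "restricted_knapsack_set n a b N0 N1 =
    {x \<in> knapsack_set n a b. (\<forall>i\<in>N0. x i = 0) \<and> (\<forall>i\<in>N1. x i = 1)}"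

definition valid_inequality ::
    "nat \<Rightarrow> (nat \<Rightarrow> real) \<Rightarrow> real \<Rightarrow> (nat \<Rightarrow> real) set \<Rightarrow> bool"
  where "valid_inequality l \<alpha> \<beta> S \<longleftrightarrow> (\<forall>x\<in>S. (\<Sum>i=1..l. \<alpha> i * x i) \<le> \<beta>)"

text \<open>The value \<open>F\<^sub>k(z)\<close>. For nonnegative weights the maximum is over a nonempty set exactly if
  \<open>z \<ge> 0\<close>; for \<open>z < 0\<close> the problem is infeasible and the value is unspecified.\<close>

definition knapsack_value :: "(nat \<Rightarrow> real) \<Rightarrow> (nat \<Rightarrow> real) \<Rightarrow> nat \<Rightarrow> real \<Rightarrow> real"
  where "knapsack_value a \<alpha> k z =
    Max ((\<lambda>x. \<Sum>i=1..k. \<alpha> i * x i) ` knapsack_set k a z)"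

definition unlifted :: "nat \<Rightarrow> nat set \<Rightarrow> nat \<Rightarrow> nat set"
  where "unlifted l M k = M - {l+1..k}"

definition lifting_cap ::
    "(nat \<Rightarrow> real) \<Rightarrow> real \<Rightarrow> nat \<Rightarrow> nat set \<Rightarrow> nat \<Rightarrow> real"
  where "lifting_cap a b l N1 k = b - (\<Sum>i\<in>unlifted l N1 k. a i)"

definition lifting_rhs ::
    "(nat \<Rightarrow> real) \<Rightarrow> real \<Rightarrow> nat \<Rightarrow> nat set \<Rightarrow> nat \<Rightarrow> real"
  where "lifting_rhs \<alpha> \<beta> l N1 k = \<beta> + (\<Sum>i\<in>N1 - unlifted l N1 k. \<alpha> i)"

text \<open>\<open>\<alpha>\<close> is the coefficient vector produced by the sequential lifting process from its first
  \<open>l\<close> entries. The values \<open>F\<^sub>j\<close> used here are those of the maximization problem, at arbitrary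
  capacities.\<close>

definition sequentially_lifted ::
    "nat \<Rightarrow> (nat \<Rightarrow> real) \<Rightarrow> real \<Rightarrow> nat \<Rightarrow> nat set \<Rightarrow> nat set \<Rightarrow> real \<Rightarrow> (nat \<Rightarrow> real) \<Rightarrow> bool"
  where "sequentially_lifted n a b l N0 N1 \<beta> \<alpha> \<longleftrightarrow>
    (\<forall>j\<in>{l..<n}.
      (j + 1 \<in> unlifted l N0 j \<longrightarrow>
        \<alpha> (j + 1) =
          (if lifting_cap a b l N1 j < a (j + 1) then 0
           else lifting_rhs \<alpha> \<beta> l N1 j
                - knapsack_value a \<alpha> j (lifting_cap a b l N1 j - a (j + 1)))) \<and>
      (j + 1 \<in> unlifted l N1 j \<longrightarrow>
        \<alpha> (j + 1) =
          knapsack_value a \<alpha> j (lifting_cap a b l N1 j + a (j + 1))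
          - lifting_rhs \<alpha> \<beta> l N1 j))"

definition down_lifting_feasible ::
    "nat \<Rightarrow> (nat \<Rightarrow> real) \<Rightarrow> real \<Rightarrow> nat \<Rightarrow> nat set \<Rightarrow> bool"
  where "down_lifting_feasible n a b l N1 \<longleftrightarrow>
    (\<forall>j\<in>{l..<n}. j + 1 \<in> unlifted l N1 j \<longrightarrow> lifting_cap a b l N1 j + a (j + 1) > 0)"

text \<open>The calculation from partial knowledge. A table \<open>T :: real \<rightharpoonup> real\<close> records the known values
  \<open>T z = Some (F\<^sub>j(z))\<close>; an unknown value is \<open>None\<close>, and whatever needs an unknown value is itself
  \<open>None\<close>. Apart from the weights and the partition, the calculation has access only to the table,
  the current capacity and the current right-hand side, not to the function \<open>F\<close>.\<close>

type_synonym value_table = "real \<rightharpoonup> real"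

definition up_lifting :: "value_table \<Rightarrow> real \<Rightarrow> real \<Rightarrow> real \<Rightarrow> real option"
  where "up_lifting T cap rhs w =
    (if cap < w then Some 0 else map_option (\<lambda>v. rhs - v) (T (cap - w)))"

definition down_lifting :: "value_table \<Rightarrow> real \<Rightarrow> real \<Rightarrow> real \<Rightarrow> real option"
  where "down_lifting T cap rhs w = map_option (\<lambda>v. v - rhs) (T (cap + w))"

definition bellman :: "value_table \<Rightarrow> real \<Rightarrow> real \<Rightarrow> value_table"
  where "bellman T w c = (\<lambda>z.
    if z < w then T z
    else Option.bind (T z) (\<lambda>u. Option.bind (T (z - w)) (\<lambda>v. Some (max u (v + c)))))"

text \<open>The state is (table, capacity, right-hand side, coefficients calculated so far).\<close>

type_synonym lifting_state = "value_table \<times> real \<times> real \<times> (nat \<rightharpoonup> real)"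

fun lifting_step ::
    "(nat \<Rightarrow> real) \<Rightarrow> nat set \<Rightarrow> nat set \<Rightarrow> nat \<Rightarrow> lifting_state \<Rightarrow> lifting_state option"
  where "lifting_step a N0 N1 i (T, cap, rhs, \<gamma>) =
    (if i \<in> N0 then
       map_option (\<lambda>c. (bellman T (a i) c, cap, rhs, \<gamma>(i \<mapsto> c)))
         (up_lifting T cap rhs (a i))
     else if i \<in> N1 then
       map_option (\<lambda>c. (bellman T (a i) c, cap + a i, rhs + c, \<gamma>(i \<mapsto> c)))
         (down_lifting T cap rhs (a i))
     else None)"

fun lifting_calculation ::
    "(nat \<Rightarrow> real) \<Rightarrow> nat set \<Rightarrow> nat set \<Rightarrow> nat list \<Rightarrow> lifting_state \<Rightarrow> lifting_state option"
  where
    "lifting_calculation a N0 N1 [] s = Some s"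
  | "lifting_calculation a N0 N1 (i # is) s =
      Option.bind (lifting_step a N0 N1 i s) (lifting_calculation a N0 N1 is)"

end

theory Submission
  imports Defs
begin

text \<open>The lifting problems and the Bellman recursion read \<open>F\<^sub>k\<close> only inside a window
  \<open>[(b - \<Sum>i>k. a i)\<^sup>+, b]\<close>, and this window shrinks at the right speed as \<open>k\<close> grows.

  The capacity \<open>b\<^sup>k\<close> is \<open>b\<close> minus the weights of the indices of \<open>N1\<close> that are not yet lifted, and
  all of these indices exceed \<open>k\<close>. Up-lifting \<open>x\<^bsub>k+1\<^esub>\<close> subtracts one more weight with an index
  above \<open>k\<close>, namely that of \<open>k+1\<close>, which is not in \<open>N1\<close>; down-lifting gives one of the subtracted
  weights back. In both cases the capacity at which \<open>F\<^sub>k\<close> is read has the form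
  \<open>b - \<Sum>i\<in>S. a i\<close> with \<open>S \<subseteq> {k+1..n}\<close>, so nonnegativity of the weights puts it in the window as
  soon as it is nonnegative (\<open>capacity_in_window\<close>).

  In passing from \<open>k\<close> to \<open>k+1\<close> the lower end \<open>b - \<Sum>i>k. a i\<close> rises by exactly \<open>a (k+1)\<close>, while
  the Bellman recursion for \<open>F\<^bsub>k+1\<^esub>(z)\<close> reads \<open>F\<^sub>k\<close> at \<open>z\<close> and at most \<open>a (k+1)\<close> below it. Hence the
  values of \<open>F\<^sub>k\<close> on the old window determine those of \<open>F\<^bsub>k+1\<^esub>\<close> on the new one
  (\<open>bellman_correct_table\<close>). One step of the calculation is therefore correct and reproduces the
  situation that it started from (\<open>lifting_step_correct\<close>), and the result follows by induction on
  the number of variables that remain to be lifted.\<close>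

section \<open>The Bellman recursion\<close>

lemma finite_binary_vectors: "finite (binary_vectors k)"
proof -
  have "binary_vectors k \<subseteq> (\<lambda>S i. if i \<in> S then 1 else 0) ` Pow {1..k}"
  proof
    fix x assume x: "x \<in> binary_vectors k"
    have "x = (\<lambda>i. if i \<in> {i\<in>{1..k}. x i = 1} then 1 else 0)"
      using x by (auto simp: binary_vectors_def fun_eq_iff)
    then show "x \<in> (\<lambda>S i. if i \<in> S then 1 else 0) ` Pow {1..k}" by blast
  qed
  then show ?thesis by (rule finite_subset) simp
qed

lemma finite_knapsack_set: "finite (knapsack_set k a z)"
  using finite_binary_vectors by (simp add: knapsack_set_def)

lemma zero_in_knapsack_set: "z \<ge> 0 \<Longrightarrow> (\<lambda>i. 0) \<in> knapsack_set k a z"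
  by (simp add: knapsack_set_def binary_vectors_def)

lemma knapsack_set_empty:
  assumes "\<And>i. i \<in> {1..k} \<Longrightarrow> a i \<ge> 0" and "z < 0"
  shows "knapsack_set k a z = {}"
proof -
  have "(\<Sum>i=1..k. a i * x i) \<ge> 0" if x: "x \<in> binary_vectors k" for x
  proof (intro sum_nonneg mult_nonneg_nonneg)
    fix i assume i: "i \<in> {1..k}"
    then show "a i \<ge> 0" by (rule assms(1))
    have "x i = 0 \<or> x i = 1" using x i by (simp add: binary_vectors_def)
    then show "x i \<ge> 0" by auto
  qed
  then show ?thesis using assms(2) by (force simp: knapsack_set_def)
qed

lemma knapsack_set_Suc:
  "knapsack_set (Suc k) a z =
    knapsack_set k a z \<union> (\<lambda>x. x(Suc k := 1)) ` knapsack_set k a (z - a (Suc k))"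
    (is "?L = ?A \<union> ?B")
proof
  show "?L \<subseteq> ?A \<union> ?B"
  proof
    fix x assume x: "x \<in> ?L"
    then have "x (Suc k) = 0 \<or> x (Suc k) = 1"
      by (auto simp: knapsack_set_def binary_vectors_def)
    then show "x \<in> ?A \<union> ?B"
    proof
      assume x0: "x (Suc k) = 0"
      have "x i = 0" if "i \<notin> {1..k}" for i
        using x x0 that by (cases "i = Suc k") (auto simp: knapsack_set_def binary_vectors_def)
      then have "x \<in> ?A"
        using x x0 by (simp add: knapsack_set_def binary_vectors_def)
      then show ?thesis by blast
    next
      assume x1: "x (Suc k) = 1"
      let ?y = "x(Suc k := 0)"
      have "?y \<in> knapsack_set k a (z - a (Suc k))"
        using x x1 by (auto simp: knapsack_set_def binary_vectors_def)
      moreover have "x = ?y(Suc k := 1)" using x1 by auto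
      ultimately show ?thesis by blast
    qed
  qed
  show "?A \<union> ?B \<subseteq> ?L"
    by (auto simp: knapsack_set_def binary_vectors_def le_Suc_eq) force
qed

text \<open>A maximizer either leaves the last item out or packs it and fills the remaining capacity
  optimally. The second option is void if the item does not fit.\<close>

lemma knapsack_value_Suc:
  assumes "\<And>i. i \<in> {1..k} \<Longrightarrow> a i \<ge> 0" and "z \<ge> 0"
  shows "knapsack_value a \<alpha> (Suc k) z =
    (if z < a (Suc k) then knapsack_value a \<alpha> k z
     else max (knapsack_value a \<alpha> k z)
              (knapsack_value a \<alpha> k (z - a (Suc k)) + \<alpha> (Suc k)))"
proof -
  let ?f = "\<lambda>k x. \<Sum>i=1..k. \<alpha> i * x i"
  let ?K = "\<lambda>z. knapsack_set k a z"
  have skip: "?f (Suc k) ` ?K z = ?f k ` ?K z"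
    by (intro image_cong) (auto simp: knapsack_set_def binary_vectors_def)
  have pack: "?f (Suc k) ` (\<lambda>x. x(Suc k := 1)) ` ?K y
      = (\<lambda>v. v + \<alpha> (Suc k)) ` ?f k ` ?K y" for y
    by (auto simp: image_image)
  have split: "?f (Suc k) ` knapsack_set (Suc k) a z
      = ?f k ` ?K z \<union> (\<lambda>v. v + \<alpha> (Suc k)) ` ?f k ` ?K (z - a (Suc k))"
    unfolding knapsack_set_Suc image_Un skip pack ..
  show ?thesis
  proof (cases "z < a (Suc k)")
    case True
    then have "?K (z - a (Suc k)) = {}" using assms(1) by (intro knapsack_set_empty) auto
    then show ?thesis using True split by (simp add: knapsack_value_def)
  next
    case False
    have ne: "?K z \<noteq> {}" "?K (z - a (Suc k)) \<noteq> {}"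
      using zero_in_knapsack_set[of z k a] zero_in_knapsack_set[of "z - a (Suc k)" k a]
        assms(2) False by auto
    have "Max ((\<lambda>v. v + \<alpha> (Suc k)) ` ?f k ` ?K (z - a (Suc k)))
        = Max (?f k ` ?K (z - a (Suc k))) + \<alpha> (Suc k)"
      using ne finite_knapsack_set
      by (intro mono_Max_commute[symmetric]) (auto intro: monoI)
    then show ?thesis
      using False ne finite_knapsack_set split
      by (simp add: knapsack_value_def Max_Un)
  qed
qed

section \<open>The window of known values\<close>

definition correct_table ::
    "nat \<Rightarrow> (nat \<Rightarrow> real) \<Rightarrow> real \<Rightarrow> (nat \<Rightarrow> real) \<Rightarrow> nat \<Rightarrow> value_table \<Rightarrow> bool"
  where "correct_table n a b \<alpha> k T \<longleftrightarrow>
    (\<forall>z\<in>{max (b - (\<Sum>i=k+1..n. a i)) 0..b}. T z = Some (knapsack_value a \<alpha> k z))"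

lemma correct_tableD:
  "correct_table n a b \<alpha> k T \<Longrightarrow> b - (\<Sum>i=k+1..n. a i) \<le> z \<Longrightarrow> 0 \<le> z \<Longrightarrow> z \<le> b
    \<Longrightarrow> T z = Some (knapsack_value a \<alpha> k z)"
  by (simp add: correct_table_def)

text \<open>The lower end of the window rises by \<open>a (k+1)\<close>, which is how far below \<open>z\<close> the recursion
  reads.\<close>

lemma bellman_correct_table:
  assumes pos: "\<And>i. i \<in> {1..n} \<Longrightarrow> a i > 0" and "k < n"
    and T: "correct_table n a b \<alpha> k T"
  shows "correct_table n a b \<alpha> (Suc k) (bellman T (a (Suc k)) (\<alpha> (Suc k)))"
  unfolding correct_table_def
proof
  fix z assume z: "z \<in> {max (b - (\<Sum>i=Suc k+1..n. a i)) 0..b}"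
  have tail: "(\<Sum>i=k+1..n. a i) = a (Suc k) + (\<Sum>i=Suc k+1..n. a i)"
    using \<open>k < n\<close> by (simp add: sum.atLeast_Suc_atMost)
  have a: "a (Suc k) > 0" using pos \<open>k < n\<close> by simp
  have rec: "knapsack_value a \<alpha> (Suc k) z =
      (if z < a (Suc k) then knapsack_value a \<alpha> k z
       else max (knapsack_value a \<alpha> k z)
                (knapsack_value a \<alpha> k (z - a (Suc k)) + \<alpha> (Suc k)))"
    using pos \<open>k < n\<close> z by (intro knapsack_value_Suc) (auto intro!: less_imp_le)
  have at: "T z = Some (knapsack_value a \<alpha> k z)"
    using z tail a by (intro correct_tableD[OF T]) auto
  have below: "T (z - a (Suc k)) = Some (knapsack_value a \<alpha> k (z - a (Suc k)))"
    if "\<not> z < a (Suc k)"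
    using that z tail a by (intro correct_tableD[OF T]) auto
  show "bellman T (a (Suc k)) (\<alpha> (Suc k)) z = Some (knapsack_value a \<alpha> (Suc k) z)"
    using at below by (simp add: bellman_def rec)
qed

text \<open>The capacities of the lifting problems arise from \<open>b\<close> by reserving space for some of the
  items above \<open>k\<close>.\<close>

lemma capacity_in_window:
  fixes a :: "nat \<Rightarrow> real"
  assumes pos: "\<And>i. i \<in> {1..n} \<Longrightarrow> a i > 0" and "S \<subseteq> {k+1..n}"
  shows "b - (\<Sum>i=k+1..n. a i) \<le> b - (\<Sum>i\<in>S. a i)" and "b - (\<Sum>i\<in>S. a i) \<le> b"
proof -
  have nonneg: "a i \<ge> 0" if "i \<in> {k+1..n}" for i
    by (intro less_imp_le pos) (use that in auto)
  show "b - (\<Sum>i=k+1..n. a i) \<le> b - (\<Sum>i\<in>S. a i)"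
    using sum_mono2[of "{k+1..n}" S a] assms(2) nonneg by auto
  have "(\<Sum>i\<in>S. a i) \<ge> 0"
    using assms(2) by (intro sum_nonneg nonneg) blast
  then show "b - (\<Sum>i\<in>S. a i) \<le> b" by simp
qed

section \<open>Capacity and right-hand side along the lifting order\<close>

lemma unlifted_Suc: "l \<le> k \<Longrightarrow> unlifted l M (Suc k) = unlifted l M k - {Suc k}"
  by (auto simp: unlifted_def)

lemma Suc_in_unlifted_iff: "Suc k \<in> unlifted l M k \<longleftrightarrow> Suc k \<in> M"
  by (simp add: unlifted_def)

lemma unlifted_subset:
  assumes "M \<subseteq> {l+1..n}" shows "unlifted l M k \<subseteq> {k+1..n}"
  using assms by (force simp: unlifted_def)

lemma lifting_cap_Suc:
  assumes "finite N1" "l \<le> k"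
  shows "lifting_cap a b l N1 (Suc k) =
    lifting_cap a b l N1 k + (if Suc k \<in> N1 then a (Suc k) else 0)"
proof -
  have "finite (unlifted l N1 k)" using assms(1) by (simp add: unlifted_def)
  then show ?thesis
    using assms(2) by (simp add: lifting_cap_def unlifted_Suc sum_diff1 Suc_in_unlifted_iff)
qed

lemma lifting_rhs_Suc:
  assumes "finite N1" "l \<le> k"
  shows "lifting_rhs \<alpha> \<beta> l N1 (Suc k) =
    lifting_rhs \<alpha> \<beta> l N1 k + (if Suc k \<in> N1 then \<alpha> (Suc k) else 0)"
proof (cases "Suc k \<in> N1")
  case True
  then have "N1 - unlifted l N1 (Suc k) = insert (Suc k) (N1 - unlifted l N1 k)"
    using assms(2) by (auto simp: unlifted_Suc)
  moreover have "Suc k \<notin> N1 - unlifted l N1 k"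
    by (simp add: unlifted_def)
  ultimately show ?thesis using True assms(1) by (simp add: lifting_rhs_def)
next
  case False
  then have "N1 - unlifted l N1 (Suc k) = N1 - unlifted l N1 k"
    using assms(2) by (auto simp: unlifted_Suc)
  then show ?thesis using False by (simp add: lifting_rhs_def)
qed

section \<open>Correctness of the calculation\<close>

text \<open>Up-lifting reserves space for the items of \<open>N1\<close> still to come and for item \<open>k+1\<close>;
  down-lifting reserves it for the former without item \<open>k+1\<close>. Either way the value that is read
  lies in the window.\<close>

lemma lifting_step_correct:
  assumes pos: "\<And>i. i \<in> {1..n} \<Longrightarrow> a i > 0"
    and order: "l \<le> k" "k < n"
    and part: "N0 \<union> N1 = {l+1..n}" "N0 \<inter> N1 = {}"
    and lifted: "sequentially_lifted n a b l N0 N1 \<beta> \<alpha>"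
    and feas: "down_lifting_feasible n a b l N1"
    and T: "correct_table n a b \<alpha> k T"
  shows "lifting_step a N0 N1 (Suc k) (T, lifting_cap a b l N1 k, lifting_rhs \<alpha> \<beta> l N1 k, \<gamma>) =
    Some (bellman T (a (Suc k)) (\<alpha> (Suc k)),
          lifting_cap a b l N1 (Suc k), lifting_rhs \<alpha> \<beta> l N1 (Suc k),
          \<gamma>(Suc k \<mapsto> \<alpha> (Suc k)))"
proof -
  let ?U = "unlifted l N1 k" and ?cap = "lifting_cap a b l N1 k"
    and ?rhs = "lifting_rhs \<alpha> \<beta> l N1 k"
  have U: "?U \<subseteq> {k+1..n}" using part by (intro unlifted_subset) auto
  then have finU: "finite ?U" by (rule finite_subset) simp
  have "finite N1" using part(1) by (metis finite_Un finite_atLeastAtMost)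
  note Suc_state = lifting_cap_Suc[OF this order(1)] lifting_rhs_Suc[OF this order(1)]
  have k: "k \<in> {l..<n}" using order by simp
  have "Suc k \<in> N0 \<union> N1" using order part(1) by simp
  then consider (up) "Suc k \<in> N0" "Suc k \<notin> N1" | (down) "Suc k \<in> N1" "Suc k \<notin> N0"
    using part(2) by blast
  then show ?thesis
  proof cases
    case up
    have \<alpha>: "\<alpha> (Suc k) = (if ?cap < a (Suc k) then 0
        else ?rhs - knapsack_value a \<alpha> k (?cap - a (Suc k)))"
      using lifted k up by (simp add: sequentially_lifted_def Suc_in_unlifted_iff)
    have reserve: "?cap - a (Suc k) = b - (\<Sum>i\<in>insert (Suc k) ?U. a i)"
      using up finU by (simp add: lifting_cap_def Suc_in_unlifted_iff)
    have sub: "insert (Suc k) ?U \<subseteq> {k+1..n}" using U order by simp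
    have "T (?cap - a (Suc k)) = Some (knapsack_value a \<alpha> k (?cap - a (Suc k)))"
      if "\<not> ?cap < a (Suc k)"
    proof (rule correct_tableD[OF T])
      show "b - (\<Sum>i=k+1..n. a i) \<le> ?cap - a (Suc k)" "?cap - a (Suc k) \<le> b"
        unfolding reserve using capacity_in_window[OF pos sub] by auto
    qed (use that in simp)
    then have "up_lifting T ?cap ?rhs (a (Suc k)) = Some (\<alpha> (Suc k))"
      using \<alpha> by (simp add: up_lifting_def)
    then show ?thesis using up by (simp add: Suc_state)
  next
    case down
    have \<alpha>: "\<alpha> (Suc k) = knapsack_value a \<alpha> k (?cap + a (Suc k)) - ?rhs"
      using lifted k down by (simp add: sequentially_lifted_def Suc_in_unlifted_iff)
    have reserve: "?cap + a (Suc k) = b - (\<Sum>i\<in>?U - {Suc k}. a i)"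
      using down finU by (simp add: lifting_cap_def sum_diff1 Suc_in_unlifted_iff)
    have sub: "?U - {Suc k} \<subseteq> {k+1..n}" using U by blast
    have "?cap + a (Suc k) > 0"
      using feas k down by (simp add: down_lifting_feasible_def Suc_in_unlifted_iff)
    then have "T (?cap + a (Suc k)) = Some (knapsack_value a \<alpha> k (?cap + a (Suc k)))"
      using capacity_in_window[OF pos sub, where b = b] reserve by (intro correct_tableD[OF T]) auto
    then have "down_lifting T ?cap ?rhs (a (Suc k)) = Some (\<alpha> (Suc k))"
      using \<alpha> by (simp add: down_lifting_def)
    then show ?thesis using down by (simp add: Suc_state)
  qed
qed

text \<open>The induction runs downwards from \<open>k = n\<close>, since the calculation processes its list of
  indices from the front. The coefficients already recorded in \<open>\<gamma>\<close> are arbitrary and must be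
  known to survive, or the coefficient written in the first step would be lost.\<close>

lemma lifting_calculation_correct:
  assumes pos: "\<And>i. i \<in> {1..n} \<Longrightarrow> a i > 0"
    and order: "l \<le> k" "k \<le> n"
    and part: "N0 \<union> N1 = {l+1..n}" "N0 \<inter> N1 = {}"
    and lifted: "sequentially_lifted n a b l N0 N1 \<beta> \<alpha>"
    and feas: "down_lifting_feasible n a b l N1"
    and T: "correct_table n a b \<alpha> k T"
  shows "\<exists>T' cap rhs \<gamma>'.
    lifting_calculation a N0 N1 [k+1..<n+1]
      (T, lifting_cap a b l N1 k, lifting_rhs \<alpha> \<beta> l N1 k, \<gamma>) = Some (T', cap, rhs, \<gamma>')
    \<and> (\<forall>i\<in>{k+1..n}. \<gamma>' i = Some (\<alpha> i)) \<and> (\<forall>i\<le>k. \<gamma>' i = \<gamma> i)"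
  using order(2,1) T
proof (induction k arbitrary: T \<gamma> rule: inc_induct)
  case base
  then show ?case by simp
next
  case (step k)
  let ?T = "bellman T (a (Suc k)) (\<alpha> (Suc k))" and ?\<gamma> = "\<gamma>(Suc k \<mapsto> \<alpha> (Suc k))"
  have "correct_table n a b \<alpha> (Suc k) ?T"
    using pos step by (intro bellman_correct_table) auto
  then obtain T' cap rhs \<gamma>' where
    calc: "lifting_calculation a N0 N1 [Suc k+1..<n+1]
      (?T, lifting_cap a b l N1 (Suc k), lifting_rhs \<alpha> \<beta> l N1 (Suc k), ?\<gamma>)
      = Some (T', cap, rhs, \<gamma>')"
    and new: "\<forall>i\<in>{Suc k+1..n}. \<gamma>' i = Some (\<alpha> i)" and old: "\<forall>i\<le>Suc k. \<gamma>' i = ?\<gamma> i"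
    using step.IH[OF le_SucI[OF step.prems(1)], of ?T ?\<gamma>] by blast
  have "[k+1..<n+1] = Suc k # [Suc k+1..<n+1]"
    using step.hyps by (simp add: upt_rec)
  then have "lifting_calculation a N0 N1 [k+1..<n+1]
      (T, lifting_cap a b l N1 k, lifting_rhs \<alpha> \<beta> l N1 k, \<gamma>) = Some (T', cap, rhs, \<gamma>')"
    using calc lifting_step_correct[OF pos step.prems(1) step.hyps(2) part lifted feas
        step.prems(2)] by simp
  moreover have "\<gamma>' i = Some (\<alpha> i)" if "i \<in> {k+1..n}" for i
    using that new old by (cases "i = Suc k") auto
  moreover have "\<gamma>' i = \<gamma> i" if "i \<le> k" for i
    using that old by simp
  ultimately show ?case by blast
qed

theorem theorem2:
  fixes n l k :: nat and a \<alpha> :: "nat \<Rightarrow> real" and b \<beta> :: real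
    and C N0 N1 :: "nat set" and T :: "real \<rightharpoonup> real"
  assumes "\<forall>i\<in>{1..n}. a i \<in> \<rat> \<and> 0 < a i \<and> a i \<le> b"
    and "b \<in> \<rat>" and "b \<ge> 0"
    and "(\<Sum>i=1..n. a i) > b"
    and "C = {1..l}"
    and "C \<union> N0 \<union> N1 = {1..n}"
    and "C \<inter> N0 = {}" and "C \<inter> N1 = {}" and "N0 \<inter> N1 = {}"
    and "valid_inequality l \<alpha> \<beta> (convex hull (restricted_knapsack_set n a b N0 N1))"
    and "sequentially_lifted n a b l N0 N1 \<beta> \<alpha>"
    and "down_lifting_feasible n a b l N1"
    and "l \<le> k" and "k \<le> n"
    and known: "\<forall>z\<in>{max (b - (\<Sum>i=k+1..n. a i)) 0..b}. T z = Some (knapsack_value a \<alpha> k z)"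
  shows "\<exists>T' cap rhs \<gamma>.
    lifting_calculation a N0 N1 [k+1..<n+1]
      (T, lifting_cap a b l N1 k, lifting_rhs \<alpha> \<beta> l N1 k, Map.empty)
      = Some (T', cap, rhs, \<gamma>)
    \<and> (\<forall>i\<in>{k+1..n}. \<gamma> i = Some (\<alpha> i))"
proof -
  have pos: "a i > 0" if "i \<in> {1..n}" for i using assms(1) that by blast
  have "N0 \<union> N1 = {1..n} - {1..l}" using assms(5-8) by blast
  also have "\<dots> = {l+1..n}" by auto
  finally have part: "N0 \<union> N1 = {l+1..n}" .
  have "correct_table n a b \<alpha> k T" using known by (simp add: correct_table_def)
  from lifting_calculation_correct[OF pos \<open>l \<le> k\<close> \<open>k \<le> n\<close> part \<open>N0 \<inter> N1 = {}\<close>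
      \<open>sequentially_lifted n a b l N0 N1 \<beta> \<alpha>\<close> \<open>down_lifting_feasible n a b l N1\<close> this,
      of Map.empty]
  show ?thesis by blast
qed

end
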